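(* Let $X,Y\in\mathcal M_{mn}$. Then $D_X^J\leq D_Y^J$ in $\mathcal M_{mn}^J$ if and only if one of the following holds: (i) $X=Y$; (ii) $\operatorname{rank}(X)\leq\operatorname{rank}(JYJ)$; (iii) $\operatorname{Row}(X)\subseteq\operatorname{Row}(JY)$; (iv) $\operatorname{Col}(X)\subseteq\operatorname{Col}(YJ)$.
   Context: Let $\mathbb F$ be a field, $m,n\geq1$ integers, and $0\leq r\leq\min(m,n)$. $\mathcal M_{kl}$ denotes the set of all $k\times l$ matrices over $\mathbb F$. Let $J=\begin{bmatrix}I_r&O\\O&O\end{bmatrix}\in\mathcal M_{nm}$ (an $n\times m$ matrix), and let $\mathcal M_{mn}^J$ be the semigroup with underlying set $\mathcal M_{mn}$ and operation $X\star Y=XJY$. $\operatorname{Row}$ and $\operatorname{Col}$ denote row and column space. $\mathcal D^J$ and $\mathcal J^J$ are the usual Green's relations of the semigroup $\mathcal M_{mn}^J$ (in this semigroup $\mathcal D^J=\mathcal J^J$), and $D_X^J$ is the $\mathcal D^J$-class of $X$. The partial order on $\mathcal D^J=\mathcal J^J$-classes is the usual one: $D_X^J\leq D_Y^J$ iff $X$ lies in the principal two-sided ideal generated by $Y$, i.e. $X=Y$, or $X=U\star Y$, or $X=Y\star V$, or $X=U\star Y\star V$ for some $U,V\in\mathcal M_{mn}$. *)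

theory Defs
  imports "Jordan_Normal_Form.DL_Rank"
begin

text \<open>
  A semigroup is given by a carrier set \<open>S\<close> and an operation \<open>f\<close> under which \<open>S\<close> is closed
  and which is associative on \<open>S\<close>. The principal ideals are those of the semigroup with an identity
  adjoined, i.e. \<open>S\<^sup>1 a\<close>, \<open>a S\<^sup>1\<close> and \<open>S\<^sup>1 a S\<^sup>1\<close>.
\<close>

definition principal_left_ideal :: "'b set \<Rightarrow> ('b \<Rightarrow> 'b \<Rightarrow> 'b) \<Rightarrow> 'b \<Rightarrow> 'b set" where
  "principal_left_ideal S f a = {a} \<union> {f u a | u. u \<in> S}"

definition principal_right_ideal :: "'b set \<Rightarrow> ('b \<Rightarrow> 'b \<Rightarrow> 'b) \<Rightarrow> 'b \<Rightarrow> 'b set" where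
  "principal_right_ideal S f a = {a} \<union> {f a v | v. v \<in> S}"

definition principal_ideal :: "'b set \<Rightarrow> ('b \<Rightarrow> 'b \<Rightarrow> 'b) \<Rightarrow> 'b \<Rightarrow> 'b set" where
  "principal_ideal S f a =
     {a} \<union> {f u a | u. u \<in> S} \<union> {f a v | v. v \<in> S} \<union> {f (f u a) v | u v. u \<in> S \<and> v \<in> S}"

definition green_L :: "'b set \<Rightarrow> ('b \<Rightarrow> 'b \<Rightarrow> 'b) \<Rightarrow> 'b rel" where
  "green_L S f = {(a, b). a \<in> S \<and> b \<in> S \<and> principal_left_ideal S f a = principal_left_ideal S f b}"

definition green_R :: "'b set \<Rightarrow> ('b \<Rightarrow> 'b \<Rightarrow> 'b) \<Rightarrow> 'b rel" where
  "green_R S f = {(a, b). a \<in> S \<and> b \<in> S \<and> principal_right_ideal S f a = principal_right_ideal S f b}"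

definition green_D :: "'b set \<Rightarrow> ('b \<Rightarrow> 'b \<Rightarrow> 'b) \<Rightarrow> 'b rel" where
  "green_D S f = green_L S f O green_R S f"

definition D_class :: "'b set \<Rightarrow> ('b \<Rightarrow> 'b \<Rightarrow> 'b) \<Rightarrow> 'b \<Rightarrow> 'b set" where
  "D_class S f a = green_D S f `` {a}"

text \<open>
  The order on classes is induced by inclusion in principal two-sided ideals. Elements of one
  \<open>D\<close>-class generate the same two-sided ideal, so the choice of representatives is immaterial.
\<close>

definition D_class_le :: "'b set \<Rightarrow> ('b \<Rightarrow> 'b \<Rightarrow> 'b) \<Rightarrow> 'b set \<Rightarrow> 'b set \<Rightarrow> bool" where
  "D_class_le S f A B \<longleftrightarrow> (\<exists>a\<in>A. \<exists>b\<in>B. a \<in> principal_ideal S f b)"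

definition J_mat :: "nat \<Rightarrow> nat \<Rightarrow> nat \<Rightarrow> 'a::field mat" where
  "J_mat n m r =
     four_block_mat (1\<^sub>m r) (0\<^sub>m r (m - r)) (0\<^sub>m (n - r) r) (0\<^sub>m (n - r) (m - r))"

definition sandwich_mult :: "'a::field mat \<Rightarrow> 'a mat \<Rightarrow> 'a mat \<Rightarrow> 'a mat" where
  "sandwich_mult J X Y = X * J * Y"

text \<open>
  The library's rank, row space and column space take the length of the vectors involved as a
  parameter; it is read off from the matrix here.
\<close>

definition mat_rank :: "'a::field mat \<Rightarrow> nat" where
  "mat_rank A = vec_space.rank (dim_row A) A"

definition Row :: "'a::field mat \<Rightarrow> 'a vec set" where
  "Row A = vec_space.row_space (dim_col A) A"

definition Col :: "'a::field mat \<Rightarrow> 'a vec set" where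
  "Col A = vec_space.col_space (dim_row A) A"

end

theory Submission
  imports Defs
begin

text \<open>
  Passing to representatives, the order on classes says that \<open>X\<close> lies in the principal ideal of
  \<open>Y\<close>, i.e. \<open>X = Y\<close>, \<open>X = U (J Y)\<close>, \<open>X = (Y J) V\<close> or \<open>X = U (J Y J) V\<close>. The second and third
  equations are solvable iff the row or column space of \<open>X\<close> is contained in that of the known factor.
  For the fourth, a matrix \<open>A\<close> of rank \<open>k\<close> factors as \<open>A = L R\<close> through dimension \<open>k\<close>, and
  \<open>W A S = I\<^sub>k\<close> for suitable \<open>W\<close>, \<open>S\<close>; hence \<open>X = U A V\<close> is solvable iff the rank of \<open>X\<close> is at
  most that of \<open>A\<close>.
\<close>

section \<open>Principal ideals and the order on D-classes\<close>

lemma principal_ideal_iff: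
  "a \<in> principal_ideal S f b \<longleftrightarrow>
     a = b \<or> (\<exists>u\<in>S. a = f u b) \<or> (\<exists>v\<in>S. a = f b v) \<or> (\<exists>u\<in>S. \<exists>v\<in>S. a = f (f u b) v)"
  unfolding principal_ideal_def by auto

text \<open>The ideal of \<open>z\<close> absorbs multiplication by \<open>S\<close> from either
  side, and \<open>x\<close> arises from \<open>y\<close> by at most one multiplication on each
  side.\<close>

lemma principal_ideal_trans:
  assumes cl: "\<And>x y. x \<in> S \<Longrightarrow> y \<in> S \<Longrightarrow> f x y \<in> S"
    and as: "\<And>x y z. x \<in> S \<Longrightarrow> y \<in> S \<Longrightarrow> z \<in> S \<Longrightarrow> f (f x y) z = f x (f y z)"
    and z: "z \<in> S" and xy: "x \<in> principal_ideal S f y" and yz: "y \<in> principal_ideal S f z"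
  shows "x \<in> principal_ideal S f z"
proof -
  have left: "f u w \<in> principal_ideal S f z" if u: "u \<in> S" and "w \<in> principal_ideal S f z" for u w
    using that(2) unfolding principal_ideal_iff[of w S f z]
  proof (elim disjE bexE)
    assume "w = z" then show ?thesis using u by (auto simp: principal_ideal_iff)
  next
    fix v assume "v \<in> S" "w = f v z"
    then show ?thesis unfolding principal_ideal_iff using u z as cl by metis
  next
    fix v assume "v \<in> S" "w = f z v"
    then show ?thesis unfolding principal_ideal_iff using u z as cl by metis
  next
    fix v v' assume "v \<in> S" "v' \<in> S" "w = f (f v z) v'"
    then have "f u w = f (f (f u v) z) v'" "f u v \<in> S" using u z as cl by metis+
    then show ?thesis unfolding principal_ideal_iff using \<open>v' \<in> S\<close> by blast
  qed
  have right: "f w u \<in> principal_ideal S f z" if u: "u \<in> S" and "w \<in> principal_ideal S f z" for u w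
    using that(2) unfolding principal_ideal_iff[of w S f z]
  proof (elim disjE bexE)
    assume "w = z" then show ?thesis using u by (auto simp: principal_ideal_iff)
  next
    fix v assume "v \<in> S" "w = f v z"
    then show ?thesis unfolding principal_ideal_iff using u by metis
  next
    fix v assume "v \<in> S" "w = f z v"
    then show ?thesis unfolding principal_ideal_iff using u z as cl by metis
  next
    fix v v' assume "v \<in> S" "v' \<in> S" "w = f (f v z) v'"
    then have "f w u = f (f v z) (f v' u)" "f v' u \<in> S" using u z as cl by metis+
    then show ?thesis unfolding principal_ideal_iff using \<open>v \<in> S\<close> by blast
  qed
  from xy show ?thesis unfolding principal_ideal_iff[of x S f y]
    using left right yz by blast
qed

text \<open>The intermediate element \<open>c\<close> generates the same left ideal as
  \<open>a\<close> and the same right ideal as \<open>b\<close>. One-sided ideals lie in the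
  two-sided ones, so transitivity through \<open>c\<close> links \<open>a\<close> and
  \<open>b\<close> in both directions.\<close>

lemma green_D_principal_ideal:
  assumes cl: "\<And>x y. x \<in> S \<Longrightarrow> y \<in> S \<Longrightarrow> f x y \<in> S"
    and as: "\<And>x y z. x \<in> S \<Longrightarrow> y \<in> S \<Longrightarrow> z \<in> S \<Longrightarrow> f (f x y) z = f x (f y z)"
    and D: "(a, b) \<in> green_D S f"
  shows "a \<in> principal_ideal S f b" "b \<in> principal_ideal S f a"
proof -
  obtain c where S: "a \<in> S" "b \<in> S"
    and L: "principal_left_ideal S f a = principal_left_ideal S f c"
    and R: "principal_right_ideal S f c = principal_right_ideal S f b"
    using D unfolding green_D_def green_L_def green_R_def by blast
  have "principal_left_ideal S f x \<subseteq> principal_ideal S f x"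
    and "principal_right_ideal S f x \<subseteq> principal_ideal S f x" for x
    unfolding principal_left_ideal_def principal_right_ideal_def principal_ideal_def by auto
  moreover have "x \<in> principal_left_ideal S f x" and "x \<in> principal_right_ideal S f x" for x
    unfolding principal_left_ideal_def principal_right_ideal_def by auto
  ultimately have "a \<in> principal_ideal S f c" "c \<in> principal_ideal S f a"
    and "b \<in> principal_ideal S f c" "c \<in> principal_ideal S f b"
    using L R by blast+
  then show "a \<in> principal_ideal S f b" "b \<in> principal_ideal S f a"
    using principal_ideal_trans[of S f, OF cl as] S by blast+
qed

text \<open>Any witnesses \<open>a'\<close>, \<open>b'\<close> can be exchanged for
  \<open>a\<close>, \<open>b\<close> by transitivity, since D-related elements lie in each other's
  ideals. Conversely \<open>a\<close> and \<open>b\<close> belong to their own classes.\<close>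

lemma D_class_le_iff_principal_ideal:
  assumes cl: "\<And>x y. x \<in> S \<Longrightarrow> y \<in> S \<Longrightarrow> f x y \<in> S"
    and as: "\<And>x y z. x \<in> S \<Longrightarrow> y \<in> S \<Longrightarrow> z \<in> S \<Longrightarrow> f (f x y) z = f x (f y z)"
    and a: "a \<in> S" and b: "b \<in> S"
  shows "D_class_le S f (D_class S f a) (D_class S f b) \<longleftrightarrow> a \<in> principal_ideal S f b"
proof
  assume "D_class_le S f (D_class S f a) (D_class S f b)"
  then obtain a' b' where a': "(a, a') \<in> green_D S f" and b': "(b, b') \<in> green_D S f"
    and ab: "a' \<in> principal_ideal S f b'"
    unfolding D_class_le_def D_class_def by blast
  have "b' \<in> S" using b' unfolding green_D_def green_R_def by blast
  with ab green_D_principal_ideal(1)[OF cl as a'] have "a \<in> principal_ideal S f b'"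
    using principal_ideal_trans[of S f, OF cl as] by blast
  with green_D_principal_ideal(2)[OF cl as b'] b show "a \<in> principal_ideal S f b"
    using principal_ideal_trans[of S f, OF cl as] by blast
next
  assume "a \<in> principal_ideal S f b"
  moreover have "(a, a) \<in> green_D S f" "(b, b) \<in> green_D S f"
    using a b unfolding green_D_def green_L_def green_R_def by blast+
  ultimately show "D_class_le S f (D_class S f a) (D_class S f b)"
    unfolding D_class_le_def D_class_def by blast
qed

section \<open>Column and row spaces and one-sided matrix equations\<close>

lemma mult_mat_assoc_dim:
  fixes A B C :: "'a::semiring_0 mat"
  assumes "dim_col A = dim_row B" "dim_col B = dim_row C"
  shows "A * B * C = A * (B * C)"
  using assms by (intro assoc_mult_mat[of A _ _ B _ C]) auto

lemma Col_eq_range: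
  "Col (A :: 'a::field mat) = {A *\<^sub>v x | x. x \<in> carrier_vec (dim_col A)}"
proof -
  interpret vec_space "TYPE('a)" "dim_row A" .
  show ?thesis unfolding Col_def col_space_eq[OF carrier_matI[OF refl refl]]
    using mult_mat_vec_carrier[OF carrier_matI[OF refl refl]] by blast
qed

text \<open>Each column of \<open>X\<close> is \<open>A\<close> times some coefficient vector; these
  vectors are the columns of \<open>V\<close>.\<close>

lemma mat_eq_mult_if_cols_mem_Col:
  fixes X A :: "'a::field mat"
  assumes X: "X \<in> carrier_mat n a" and A: "A \<in> carrier_mat n b"
    and cols: "set (cols X) \<subseteq> Col A"
  shows "\<exists>V\<in>carrier_mat b a. X = A * V"
proof -
  have "\<exists>x\<in>carrier_vec b. col X j = A *\<^sub>v x" if "j < a" for j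
  proof -
    have "col X j \<in> Col A" using cols that X by (auto simp: cols_def)
    then show ?thesis unfolding Col_eq_range using A by auto
  qed
  then obtain x where x: "\<And>j. j < a \<Longrightarrow> x j \<in> carrier_vec b"
    and Xx: "\<And>j. j < a \<Longrightarrow> col X j = A *\<^sub>v x j" by metis
  define V where "V = mat_of_cols b (map x [0..<a])"
  have V: "V \<in> carrier_mat b a" unfolding V_def by (rule carrier_matI) simp_all
  have "col X j = col (A * V) j" if "j < a" for j
  proof -
    have "col V j = x j" unfolding V_def using that x by (subst col_mat_of_cols) auto
    then show ?thesis using Xx that col_mult2[OF A V that] by simp
  qed
  then have "X = A * V" using X A V by (intro mat_col_eqI) auto
  with V show ?thesis by blast
qed

text \<open>The columns of \<open>X\<close> lie in \<open>Col X\<close>, so inclusion lets them be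
  solved for one at a time; conversely \<open>(A * V) *\<^sub>v x\<close> is \<open>A\<close>
  applied to \<open>V *\<^sub>v x\<close>.\<close>

lemma Col_subset_iff:
  fixes X A :: "'a::field mat"
  assumes X: "X \<in> carrier_mat n a" and A: "A \<in> carrier_mat n b"
  shows "Col X \<subseteq> Col A \<longleftrightarrow> (\<exists>V\<in>carrier_mat b a. X = A * V)"
proof
  assume sub: "Col X \<subseteq> Col A"
  interpret vec_space "TYPE('a)" n .
  have "Col X = span (set (cols X))" using X by (simp add: Col_def col_space_def)
  then have "set (cols X) \<subseteq> Col X" using X cols_dim[of X] in_own_span by simp
  with sub show "\<exists>V\<in>carrier_mat b a. X = A * V"
    using mat_eq_mult_if_cols_mem_Col[OF X A] by blast
next
  assume "\<exists>V\<in>carrier_mat b a. X = A * V"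
  then obtain V where V: "V \<in> carrier_mat b a" and eq: "X = A * V" by blast
  show "Col X \<subseteq> Col A"
  proof
    fix y assume "y \<in> Col X"
    then obtain x where x: "x \<in> carrier_vec a" and y: "y = X *\<^sub>v x"
      unfolding Col_eq_range using X by auto
    have "y = A *\<^sub>v (V *\<^sub>v x)"
      unfolding y eq using A V x by (rule assoc_mult_mat_vec)
    moreover have "V *\<^sub>v x \<in> carrier_vec b" using V x by auto
    ultimately show "y \<in> Col A" unfolding Col_eq_range using A by auto
  qed
qed

lemma Row_eq_Col_transpose: "Row A = Col (transpose_mat A)"
  unfolding Row_def Col_def vec_space.row_space_eq_col_space_transpose by simp

text \<open>Transposition turns this into \<open>Col_subset_iff\<close>, with \<open>U\<close> the
  transpose of \<open>V\<close>.\<close>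

lemma Row_subset_iff:
  fixes X A :: "'a::field mat"
  assumes X: "X \<in> carrier_mat a n" and A: "A \<in> carrier_mat b n"
  shows "Row X \<subseteq> Row A \<longleftrightarrow> (\<exists>U\<in>carrier_mat a b. X = U * A)"
proof -
  have eq: "transpose_mat X = transpose_mat A * V \<longleftrightarrow> X = transpose_mat V * A"
    if V: "V \<in> carrier_mat b a" for V
  proof -
    have "transpose_mat (transpose_mat V * A) = transpose_mat A * V"
      using V A by (subst transpose_mult) auto
    then show ?thesis by (metis transpose_transpose)
  qed
  have "Row X \<subseteq> Row A \<longleftrightarrow> (\<exists>V\<in>carrier_mat b a. transpose_mat X = transpose_mat A * V)"
    unfolding Row_eq_Col_transpose by (rule Col_subset_iff) (use X A in auto)
  also have "\<dots> \<longleftrightarrow> (\<exists>V\<in>carrier_mat b a. X = transpose_mat V * A)" using eq by blast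
  also have "\<dots> \<longleftrightarrow> (\<exists>U\<in>carrier_mat a b. X = U * A)"
    by (metis transpose_carrier_mat transpose_transpose)
  finally show ?thesis .
qed

section \<open>Independent columns, one-sided inverses and rank factorizations\<close>

context vec_space
begin

text \<open>A column outside \<open>span T\<close> could be adjoined to \<open>T\<close> without
  losing independence, against maximality.\<close>

lemma cols_subset_span_maximal:
  assumes A: "A \<in> carrier_mat n nc"
    and max: "maximal T (\<lambda>T. T \<subseteq> set (cols A) \<and> lin_indpt T)"
  shows "set (cols A) \<subseteq> span T"
proof
  fix s assume s: "s \<in> set (cols A)"
  have T: "T \<subseteq> set (cols A)" "lin_indpt T" using max unfolding maximal_def by auto
  have car: "set (cols A) \<subseteq> carrier_vec n" using cols_dim A by blast
  show "s \<in> span T"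
  proof (rule ccontr)
    assume ns: "s \<notin> span T"
    have "s \<notin> T" using ns in_own_span[of T] T car by auto
    moreover have "lin_indpt (T \<union> {s})"
      using lin_dep_iff_in_span[of T s] T car s ns \<open>s \<notin> T\<close> by auto
    ultimately show False using max T s unfolding maximal_def by (metis Un_insert_right
          insert_iff insert_subset sup_bot_right subset_insertI)
  qed
qed

lemma span_eq_Col_mat_of_cols:
  assumes "set ts \<subseteq> carrier_vec n"
  shows "span (set ts) = Col (mat_of_cols n ts)"
  using assms by (simp add: Col_def col_space_def)

text \<open>
  Extending the columns of \<open>L\<close> to a maximal independent set among the columns of \<open>(L | I)\<close> gives
  a matrix \<open>M\<close> with independent columns and \<open>M V = I\<close>. Then \<open>M (V M) = M\<close> forces \<open>V M = I\<close>, so the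
  first rows of \<open>V\<close> form a left inverse of \<open>L\<close>.
\<close>

lemma left_inverse_if_lin_indpt:
  assumes us: "set us \<subseteq> carrier_vec n" "distinct us" "lin_indpt (set us)"
  shows "\<exists>W\<in>carrier_mat (length us) n. W * mat_of_cols n us = 1\<^sub>m (length us)"
proof -
  define B where "B = mat_of_cols n (us @ unit_vecs n)"
  have B: "B \<in> carrier_mat n (length (us @ unit_vecs n))" unfolding B_def by auto
  have colsB: "cols B = us @ unit_vecs n" unfolding B_def
    by (rule cols_mat_of_cols) (use us unit_vecs_carrier in auto)
  obtain T where max: "maximal T (\<lambda>T. T \<subseteq> set (cols B) \<and> lin_indpt T)" and UT: "set us \<subseteq> T"
    and finT: "finite T"
    using maximal_exists_superset[of "set (cols B)" "(\<lambda>T. T \<subseteq> set (cols B) \<and> lin_indpt T)" "set us"]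
      us colsB by auto
  obtain rs where rs: "set rs = T - set us" "distinct rs"
    using finite_distinct_list finT by (metis finite_Diff)
  \<comment> \<open>With \<open>us\<close> in front, the first \<open>length us\<close> columns of
    \<open>M\<close> are those of \<open>mat_of_cols n us\<close>.\<close>
  define ts where "ts = us @ rs"
  have ts: "distinct ts" "set ts = T" unfolding ts_def using rs us UT by auto
  have T: "T \<subseteq> carrier_vec n" "lin_indpt T"
    using max cols_dim[of B] B unfolding maximal_def by auto
  define l where "l = length ts"
  define M where "M = mat_of_cols n ts"
  have M: "M \<in> carrier_mat n l" unfolding M_def l_def by auto
  have colsM: "cols M = ts" unfolding M_def using ts T by (intro cols_mat_of_cols) auto
  \<comment> \<open>The unit vectors are columns of \<open>B\<close>, hence in the span of
    \<open>T\<close>; solving for them gives a right inverse of \<open>M\<close>.\<close>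
  have "set (cols (1\<^sub>m n)) \<subseteq> set (cols B)" unfolding colsB by (simp add: unit_vecs_def cols_def)
  then have "set (cols (1\<^sub>m n)) \<subseteq> Col M"
    using cols_subset_span_maximal[OF B max] span_eq_Col_mat_of_cols[of ts] ts T
    unfolding M_def by auto
  from mat_eq_mult_if_cols_mem_Col[OF one_carrier_mat M this]
  obtain V where V: "V \<in> carrier_mat l n" and MV: "M * V = 1\<^sub>m n" by metis
  have VM: "V * M = 1\<^sub>m l"
  proof -
    have "M * (V * M - 1\<^sub>m l) = M * (V * M) - M * 1\<^sub>m l"
      using M V by (intro mult_minus_distrib_mat) auto
    also have "M * (V * M) = (M * V) * M" using M V by (intro assoc_mult_mat[symmetric]) auto
    also have "\<dots> - M * 1\<^sub>m l = 0\<^sub>m n l" using MV M by simp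
    finally have z: "M * (V * M - 1\<^sub>m l) = 0\<^sub>m n l" .
    \<comment> \<open>\<open>M\<close> annihilates every column of the difference, and since the
      columns of \<open>M\<close> are distinct and independent, each such column is zero.\<close>
    have "V * M - 1\<^sub>m l = 0\<^sub>m l l"
    proof (rule mat_col_eqI)
      fix j assume "j < dim_col (0\<^sub>m l l :: 'a mat)"
      then have j: "j < l" by simp
      let ?v = "col (V * M - 1\<^sub>m l) j"
      have D: "V * M - 1\<^sub>m l \<in> carrier_mat l l" by auto
      have "M *\<^sub>v ?v = col (M * (V * M - 1\<^sub>m l)) j" using col_mult2[OF M D j] by simp
      also have "\<dots> = 0\<^sub>v n" unfolding z using j by simp
      finally have "M *\<^sub>v ?v = 0\<^sub>v n" .
      moreover have "?v \<in> carrier_vec l" by (intro carrier_vecI) simp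
      ultimately have "?v = 0\<^sub>v l" using lin_depI[OF M, of ?v] ts T colsM by auto
      then show "?v = col (0\<^sub>m l l) j" using j by simp
    qed (use V M in auto)
    then have "(V * M - 1\<^sub>m l) $$ (i, j) = 0" if "i < l" "j < l" for i j using that by simp
    then show ?thesis using V M by (intro eq_matI) auto
  qed
  define W where "W = mat (length us) n (\<lambda>(i,j). V $$ (i,j))"
  have "W * mat_of_cols n us = 1\<^sub>m (length us)"
  proof (rule eq_matI)
    fix i j assume "i < dim_row (1\<^sub>m (length us))" "j < dim_col (1\<^sub>m (length us))"
    then have ij: "i < length us" "j < length us" by auto
    then have ijl: "i < l" "j < l" unfolding l_def ts_def by auto
    have "row W i = row V i" using ij ijl V unfolding W_def by (intro eq_vecI) auto
    moreover have "col (mat_of_cols n us) j = col M j"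
      using ij ijl us T ts unfolding M_def l_def
      by (subst (1 2) col_mat_of_cols) (auto simp: ts_def nth_append)
    ultimately have "(W * mat_of_cols n us) $$ (i,j) = (V * M) $$ (i,j)"
      using ij ijl V M unfolding W_def by (simp add: mat_of_cols_def)
    then show "(W * mat_of_cols n us) $$ (i,j) = 1\<^sub>m (length us) $$ (i,j)"
      unfolding VM using ij ijl by simp
  qed (auto simp: W_def)
  moreover have "W \<in> carrier_mat (length us) n" unfolding W_def by simp
  ultimately show ?thesis by blast
qed

text \<open>The columns of \<open>L\<close> form a maximal independent set of columns of
  \<open>A\<close>. They span the columns of \<open>A\<close>, which gives \<open>R\<close>; they
  are themselves columns of \<open>A\<close>, which gives \<open>S\<close>; they are independent,
  which gives \<open>W\<close>. Together, \<open>W * A * S\<close> is the identity of size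
  \<open>rank A\<close>.\<close>

lemma rank_factorization_vec_space:
  assumes A: "A \<in> carrier_mat n nc"
  shows "\<exists>L\<in>carrier_mat n (rank A). \<exists>R\<in>carrier_mat (rank A) nc.
    \<exists>W\<in>carrier_mat (rank A) n. \<exists>S\<in>carrier_mat nc (rank A).
      A = L * R \<and> W * L = 1\<^sub>m (rank A) \<and> L = A * S"
proof -
  \<comment> \<open>The extension starts from the empty set, which is independent.\<close>
  obtain T where max: "maximal T (\<lambda>T. T \<subseteq> set (cols A) \<and> lin_indpt T)" and finT: "finite T"
    using maximal_exists_superset[of "set (cols A)" "(\<lambda>T. T \<subseteq> set (cols A) \<and> lin_indpt T)" "{}"]
      finite_lin_indpt2[of "{}"] by auto
  obtain us where us: "set us = T" "distinct us" using finite_distinct_list finT by blast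
  have k: "rank A = length us" using rank_card_indpt[OF A max] us distinct_card by metis
  have T: "T \<subseteq> set (cols A)" "lin_indpt T" using max unfolding maximal_def by auto
  have car: "set (cols A) \<subseteq> carrier_vec n" using cols_dim A by blast
  define L where "L = mat_of_cols n us"
  have L: "L \<in> carrier_mat n (length us)" unfolding L_def by simp
  have "set (cols A) \<subseteq> Col L"
    using cols_subset_span_maximal[OF A max] span_eq_Col_mat_of_cols[of us] us T car
    unfolding L_def by auto
  from mat_eq_mult_if_cols_mem_Col[OF A L this]
  obtain R where R: "R \<in> carrier_mat (length us) nc" "A = L * R" by blast
  have "set (cols L) = T" unfolding L_def using us T car by (subst cols_mat_of_cols) auto
  moreover have "Col A = span (set (cols A))" using A by (simp add: Col_def col_space_def)
  ultimately have "set (cols L) \<subseteq> Col A" using T car in_own_span[of "set (cols A)"] by auto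
  from mat_eq_mult_if_cols_mem_Col[OF L A this]
  obtain S where S: "S \<in> carrier_mat nc (length us)" "L = A * S" by blast
  obtain W where W: "W \<in> carrier_mat (length us) n" "W * L = 1\<^sub>m (length us)"
    using left_inverse_if_lin_indpt[of us] us T car unfolding L_def by auto
  show ?thesis unfolding k using L R S W by blast
qed

text \<open>The left inverse makes \<open>Q\<close> injective, so its \<open>k\<close> columns are
  independent in a space of dimension \<open>n\<close>.\<close>

lemma le_if_left_inverse:
  fixes P Q :: "'a mat"
  assumes P: "P \<in> carrier_mat k n" and Q: "Q \<in> carrier_mat n k" and PQ: "P * Q = 1\<^sub>m k"
  shows "k \<le> n"
proof -
  have inj: "v = 0\<^sub>v k" if v: "v \<in> carrier_vec k" "Q *\<^sub>v v = 0\<^sub>v n" for v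
  proof -
    have "v = (P * Q) *\<^sub>v v" unfolding PQ using v(1) by simp
    also have "\<dots> = P *\<^sub>v (Q *\<^sub>v v)" using P Q v(1) by (rule assoc_mult_mat_vec)
    also have "\<dots> = 0\<^sub>v k" using v P by auto
    finally show ?thesis .
  qed
  \<comment> \<open>Independence concerns the set of columns, so repetitions must be excluded for it
    to have \<open>k\<close> elements. Equal columns of \<open>Q\<close> would give equal columns of
    the identity \<open>P * Q\<close>.\<close>
  have dist: "distinct (cols Q)"
  proof (rule ccontr)
    assume "\<not> distinct (cols Q)"
    then obtain i j where ij: "i < k" "j < k" "i \<noteq> j" "col Q i = col Q j"
      using Q unfolding distinct_conv_nth by auto
    have "col (P * Q) i = col (P * Q) j"
      using ij col_mult2[OF P Q] by simp
    then have "unit_vec k i = (unit_vec k j :: 'a vec)" unfolding PQ using ij by simp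
    then show False using ij by (metis index_unit_vec(1) one_neq_zero)
  qed
  have "lin_indpt (set (cols Q))" using lin_depE[OF Q _ dist] inj by blast
  moreover have "set (cols Q) \<subseteq> carrier_vec n" using cols_dim Q by blast
  ultimately have "card (set (cols Q)) \<le> n"
    using li_le_dim(2)[OF fin_dim, of "set (cols Q)"] dim_is_n by auto
  then show ?thesis using distinct_card[OF dist] Q by simp
qed

end

section \<open>Rank inequality as a two-sided matrix equation\<close>

lemma rank_factorization:
  fixes A :: "'a::field mat"
  assumes A: "A \<in> carrier_mat a b"
  obtains L R W S where "L \<in> carrier_mat a (mat_rank A)" "R \<in> carrier_mat (mat_rank A) b"
    "W \<in> carrier_mat (mat_rank A) a" "S \<in> carrier_mat b (mat_rank A)"
    "A = L * R" "W * L = 1\<^sub>m (mat_rank A)" "L = A * S"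
proof -
  have "mat_rank A = vec_space.rank a A" using A unfolding mat_rank_def by simp
  then show thesis using vec_space.rank_factorization_vec_space[OF A] that by metis
qed

text \<open>Factoring both matrices reduces the question to identity matrices:
  \<open>1\<^sub>m k\<close> factors through dimension \<open>l\<close> exactly when
  \<open>k \<le> l\<close>.\<close>

lemma mat_rank_le_iff:
  fixes X C :: "'a::field mat"
  assumes X: "X \<in> carrier_mat a b" and C: "C \<in> carrier_mat c d"
  shows "mat_rank X \<le> mat_rank C \<longleftrightarrow>
    (\<exists>U\<in>carrier_mat a c. \<exists>V\<in>carrier_mat d b. X = U * C * V)"
proof -
  define k where "k = mat_rank X"
  define l where "l = mat_rank C"
  obtain L R W S where L: "L \<in> carrier_mat a k" and R: "R \<in> carrier_mat k b"
    and W: "W \<in> carrier_mat k a" and S: "S \<in> carrier_mat b k"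
    and f: "X = L * R" "W * L = 1\<^sub>m k" "L = X * S"
    using rank_factorization[OF X] unfolding k_def by metis
  obtain L' R' W' S' where L': "L' \<in> carrier_mat c l" and R': "R' \<in> carrier_mat l d"
    and W': "W' \<in> carrier_mat l c" and S': "S' \<in> carrier_mat d l"
    and f': "C = L' * R'" "W' * L' = 1\<^sub>m l" "L' = C * S'"
    using rank_factorization[OF C] unfolding l_def by metis
  show ?thesis
  proof
    assume "mat_rank X \<le> mat_rank C"
    then have kl: "k \<le> l" unfolding k_def l_def .
    \<comment> \<open>\<open>E\<close> and \<open>F\<close> are truncated identities;
      \<open>k \<le> l\<close> ensures that no diagonal entry is lost in
      \<open>E * F\<close>.\<close>
    define E where "E = mat k l (\<lambda>(i,j). if i = j then 1 else (0::'a))"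
    define F where "F = mat l k (\<lambda>(i,j). if i = j then 1 else (0::'a))"
    have E: "E \<in> carrier_mat k l" and F: "F \<in> carrier_mat l k" unfolding E_def F_def by auto
    have EF: "E * F = 1\<^sub>m k"
    proof (rule eq_matI)
      fix i j assume "i < dim_row (1\<^sub>m k)" "j < dim_col (1\<^sub>m k)"
      then have ij: "i < k" "j < k" by auto
      have "row E i = unit_vec l i" using ij kl unfolding E_def by (intro eq_vecI) auto
      then show "(E * F) $$ (i,j) = 1\<^sub>m k $$ (i,j)"
        using ij kl E F by (simp add: F_def)
    qed (auto simp: E_def F_def)
    \<comment> \<open>\<open>W'\<close> and \<open>S'\<close> reduce \<open>C\<close> to
      \<open>1\<^sub>m l\<close>, \<open>E\<close> and \<open>F\<close> cut this down to
      \<open>1\<^sub>m k\<close>, and \<open>L\<close> and \<open>R\<close> rebuild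
      \<open>X\<close>.\<close>
    define U where "U = L * E * W'"
    define V where "V = S' * F * R"
    have UV: "U \<in> carrier_mat a c" "V \<in> carrier_mat d b"
      unfolding U_def V_def using L E W' S' F R by auto
    have "U * C * V = L * (E * ((W' * (C * S')) * F)) * R"
      unfolding U_def V_def using L E W' S' F R C
      by (simp add: mult_mat_assoc_dim)
    also have "\<dots> = X" unfolding f'(3)[symmetric] f'(2) using EF E F L R f(1) by simp
    finally show "\<exists>U\<in>carrier_mat a c. \<exists>V\<in>carrier_mat d b. X = U * C * V" using UV by metis
  next
    assume "\<exists>U\<in>carrier_mat a c. \<exists>V\<in>carrier_mat d b. X = U * C * V"
    then obtain U V where U: "U \<in> carrier_mat a c" and V: "V \<in> carrier_mat d b"
      and eq: "X = U * C * V" by blast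
    \<comment> \<open>Inserting \<open>X = U * C * V\<close> and \<open>C = L' * R'\<close> into
      \<open>W * X * S = 1\<^sub>m k\<close> and splitting between \<open>L'\<close> and
      \<open>R'\<close> factors the identity through dimension \<open>l\<close>.\<close>
    have P: "W * U * L' \<in> carrier_mat k l" and Q: "R' * V * S \<in> carrier_mat l k"
      using W U L' R' V S by auto
    have "(W * U * L') * (R' * V * S) = W * ((U * (L' * R') * V) * S)"
      using W U L' R' V S by (simp add: mult_mat_assoc_dim)
    also have "\<dots> = 1\<^sub>m k" unfolding f'(1)[symmetric] eq[symmetric] f(3)[symmetric] by (fact f(2))
    finally show "mat_rank X \<le> mat_rank C"
      using vec_space.le_if_left_inverse[OF P Q] unfolding k_def l_def by simp
  qed
qed

section \<open>The order on D-classes of the sandwich semigroup\<close>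

theorem proposition4p6:
  fixes m n r :: nat and J X Y :: "'a::field mat"
  assumes "m \<ge> 1" and "n \<ge> 1" and "r \<le> min m n"
    and "J = J_mat n m r"
    and "X \<in> carrier_mat m n" and "Y \<in> carrier_mat m n"
  shows "D_class_le (carrier_mat m n) (sandwich_mult J)
           (D_class (carrier_mat m n) (sandwich_mult J) X)
           (D_class (carrier_mat m n) (sandwich_mult J) Y)
         \<longleftrightarrow>
           X = Y
           \<or> mat_rank X \<le> mat_rank (J * Y * J)
           \<or> Row X \<subseteq> Row (J * Y)
           \<or> Col X \<subseteq> Col (Y * J)"
proof -
  note X = assms(5) and Y = assms(6)
  have J: "J \<in> carrier_mat n m"
  proof -
    \<comment> \<open>The block sizes add up to \<open>n\<close> and \<open>m\<close> because
      \<open>r \<le> min m n\<close> keeps the natural-number subtractions exact.\<close>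
    have "J \<in> carrier_mat (r + (n - r)) (r + (m - r))"
      unfolding assms(4) J_mat_def by (intro four_block_carrier_mat) auto
    then show ?thesis using assms(3) by simp
  qed
  let ?S = "carrier_mat m n :: 'a mat set"
  have "D_class_le ?S (sandwich_mult J) (D_class ?S (sandwich_mult J) X)
      (D_class ?S (sandwich_mult J) Y) \<longleftrightarrow> X \<in> principal_ideal ?S (sandwich_mult J) Y"
  proof (rule D_class_le_iff_principal_ideal)
    fix A B C :: "'a mat"
    assume A: "A \<in> ?S" and B: "B \<in> ?S"
    then show "sandwich_mult J A B \<in> ?S" unfolding sandwich_mult_def using J by auto
    assume C: "C \<in> ?S"
    show "sandwich_mult J (sandwich_mult J A B) C = sandwich_mult J A (sandwich_mult J B C)"
      unfolding sandwich_mult_def using A B C J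
      by (simp add: mult_mat_assoc_dim)
  qed (fact X Y)+
  also have "\<dots> \<longleftrightarrow> X = Y \<or> (\<exists>U\<in>?S. X = U * (J * Y)) \<or> (\<exists>V\<in>?S. X = (Y * J) * V)
      \<or> (\<exists>U\<in>?S. \<exists>V\<in>?S. X = U * (J * Y * J) * V)"
  proof -
    \<comment> \<open>Regrouping attaches each \<open>J\<close> to \<open>Y\<close>, so that
      \<open>U\<close> and \<open>V\<close> are the only unknowns in the equations.\<close>
    have 1: "U * J * Y = U * (J * Y)" if "U \<in> ?S" for U using that J Y by auto
    have 2: "U * (J * Y) * J = U * (J * Y * J)" if "U \<in> ?S" for U
      using that J Y by (simp add: mult_mat_assoc_dim)
    show ?thesis unfolding principal_ideal_iff sandwich_mult_def by (simp add: 1 2 cong: bex_cong)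
  qed
  also have "\<dots> \<longleftrightarrow> X = Y \<or> Row X \<subseteq> Row (J * Y) \<or> Col X \<subseteq> Col (Y * J)
      \<or> mat_rank X \<le> mat_rank (J * Y * J)"
  proof -
    have JY: "J * Y \<in> carrier_mat n n" and YJ: "Y * J \<in> carrier_mat m m"
      and JYJ: "J * Y * J \<in> carrier_mat n m"
      using J Y by auto
    show ?thesis
      unfolding Row_subset_iff[OF X JY] Col_subset_iff[OF X YJ] mat_rank_le_iff[OF X JYJ] ..
  qed
  finally show ?thesis by blast
qed

end
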